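(* Let $f:A\to B$ and $g:A\to C$ be ring homomorphisms, and let $J$ be an ideal of $B$ and $J'$ an ideal of $C$ such that $I:=f^{-1}(J)=g^{-1}(J')$. Consider the ring homomorphisms $$\iota_1:\frac{A}{I}\to \frac{f(A)+J}{J}\times\frac{g(A)+J'}{J'},\quad \bar a\mapsto\left(\overline{f(a)},\overline{g(a)}\right),$$ $$\mu_2: A\bowtie^{f,g}(J,J')\to \frac{A}{I},\quad (f(a)+j,g(a)+j')\mapsto \bar a .$$ Let $\iota_2: A\bowtie^{f,g}(J,J')\to (f(A)+J)\times(g(A)+J')$ be the natural embedding and let $\mu_1:(f(A)+J)\times(g(A)+J')\to \frac{f(A)+J}{J}\times\frac{g(A)+J'}{J'}$ be the canonical surjection. Then the square formed by $\iota_2$ and $\mu_2$ (out of $A\bowtie^{f,g}(J,J')$) and $\mu_1$ and $\iota_1$ (into $\frac{f(A)+J}{J}\times\frac{g(A)+J'}{J'}$) is a conductor square with conductor $\operatorname{Ker}(\mu_1)=J\times J'$.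
   Context: All rings are commutative with unity, and ring homomorphisms are unital. The bi-amalgamation of $A$ with $(B,C)$ along $(J,J')$ with respect to $(f,g)$ is the subring of $B\times C$ $$A\bowtie^{f,g}(J,J'):=\{(f(a)+j,\,g(a)+j')\mid a\in A,\ (j,j')\in J\times J'\}.$$ Here $f(A)+J$ and $g(A)+J'$ are subrings of $B$ and $C$ respectively. A square of ring homomorphisms $\iota_2:R\to T$, $\mu_2:R\to S$, $\mu_1:T\to D$, $\iota_1:S\to D$ is a pullback (of $\mu_1$ and $\iota_1$) if $r\mapsto(\iota_2(r),\mu_2(r))$ induces an isomorphism of $R$ onto the subring $\mu_1\times_D\iota_1:=\{(t,s)\in T\times S\mid \mu_1(t)=\iota_1(s)\}$ of $T\times S$. If moreover $\mu_1$ is surjective and $\iota_1$ is injective, it is called a conductor square; in that case $\iota_2$ is injective, $\mu_2$ is surjective, and, viewing $R$ as a subring of $T$ via $\iota_2$, $\operatorname{Ker}(\mu_1)=\operatorname{Ker}(\mu_2)$ is the largest common ideal of $R$ and $T$, called the conductor of $T$ into $R$. *)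

theory Defs
  imports "HOL-Algebra.Algebra"
begin

definition image_plus_ideal ::
  "('a, 'm) ring_scheme \<Rightarrow> ('b, 'n) ring_scheme \<Rightarrow> ('a \<Rightarrow> 'b) \<Rightarrow> 'b set \<Rightarrow> ('b, 'n) ring_scheme"
  where "image_plus_ideal A B f J = B\<lparr>carrier := f ` carrier A <+>\<^bsub>B\<^esub> J\<rparr>"

definition bi_amalgamation ::
  "('a, 'm) ring_scheme \<Rightarrow> ('b, 'n) ring_scheme \<Rightarrow> ('c, 'k) ring_scheme \<Rightarrow>
   ('a \<Rightarrow> 'b) \<Rightarrow> ('a \<Rightarrow> 'c) \<Rightarrow> 'b set \<Rightarrow> 'c set \<Rightarrow> ('b \<times> 'c) ring"
  where "bi_amalgamation A B C f g J J' =
    (RDirProd B C)\<lparr>carrier :=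
      {(f a \<oplus>\<^bsub>B\<^esub> j, g a \<oplus>\<^bsub>C\<^esub> j') | a j j'. a \<in> carrier A \<and> j \<in> J \<and> j' \<in> J'}\<rparr>"

definition fiber_product ::
  "('t, 'm) ring_scheme \<Rightarrow> ('s, 'n) ring_scheme \<Rightarrow> ('t \<Rightarrow> 'd) \<Rightarrow> ('s \<Rightarrow> 'd) \<Rightarrow> ('t \<times> 's) ring"
  where "fiber_product T S \<mu>1 \<iota>1 =
    (RDirProd T S)\<lparr>carrier := {(t, s). t \<in> carrier T \<and> s \<in> carrier S \<and> \<mu>1 t = \<iota>1 s}\<rparr>"

text \<open>
  Squares are given in the order \<open>\<iota>2 : R \<rightarrow> T\<close>, \<open>\<mu>2 : R \<rightarrow> S\<close>,
  \<open>\<mu>1 : T \<rightarrow> D\<close>, \<open>\<iota>1 : S \<rightarrow> D\<close>.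
  Commutativity is part of \<open>pullback_square\<close>: the induced map is required to land in
  the fibre product.
\<close>

definition pullback_square ::
  "('r, 'k) ring_scheme \<Rightarrow> ('t, 'l) ring_scheme \<Rightarrow> ('s, 'm) ring_scheme \<Rightarrow> ('d, 'n) ring_scheme \<Rightarrow>
   ('r \<Rightarrow> 't) \<Rightarrow> ('r \<Rightarrow> 's) \<Rightarrow> ('t \<Rightarrow> 'd) \<Rightarrow> ('s \<Rightarrow> 'd) \<Rightarrow> bool"
  where "pullback_square R T S D \<iota>2 \<mu>2 \<mu>1 \<iota>1 \<longleftrightarrow>
    cring R \<and> cring T \<and> cring S \<and> cring D \<and>
    \<iota>2 \<in> ring_hom R T \<and> \<mu>2 \<in> ring_hom R S \<and> \<mu>1 \<in> ring_hom T D \<and> \<iota>1 \<in> ring_hom S D \<and>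
    (\<lambda>r. (\<iota>2 r, \<mu>2 r)) \<in> ring_iso R (fiber_product T S \<mu>1 \<iota>1)"

definition conductor_square ::
  "('r, 'k) ring_scheme \<Rightarrow> ('t, 'l) ring_scheme \<Rightarrow> ('s, 'm) ring_scheme \<Rightarrow> ('d, 'n) ring_scheme \<Rightarrow>
   ('r \<Rightarrow> 't) \<Rightarrow> ('r \<Rightarrow> 's) \<Rightarrow> ('t \<Rightarrow> 'd) \<Rightarrow> ('s \<Rightarrow> 'd) \<Rightarrow> bool"
  where "conductor_square R T S D \<iota>2 \<mu>2 \<mu>1 \<iota>1 \<longleftrightarrow>
    pullback_square R T S D \<iota>2 \<mu>2 \<mu>1 \<iota>1 \<and>
    \<mu>1 ` carrier T = carrier D \<and> inj_on \<iota>1 (carrier S)"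

text \<open>
  \<open>is_conductor R T \<iota> \<cc>\<close>: when \<open>R\<close> is viewed as a subring of \<open>T\<close> via the injection \<open>\<iota>\<close>,
  \<open>\<cc>\<close> is the largest common ideal of \<open>R\<close> and \<open>T\<close>.
\<close>

definition common_ideal ::
  "('r, 'k) ring_scheme \<Rightarrow> ('t, 'l) ring_scheme \<Rightarrow> ('r \<Rightarrow> 't) \<Rightarrow> 't set \<Rightarrow> bool"
  where "common_ideal R T \<iota> K \<longleftrightarrow> ideal K T \<and> ideal K (T\<lparr>carrier := \<iota> ` carrier R\<rparr>)"

definition is_conductor ::
  "('r, 'k) ring_scheme \<Rightarrow> ('t, 'l) ring_scheme \<Rightarrow> ('r \<Rightarrow> 't) \<Rightarrow> 't set \<Rightarrow> bool"
  where "is_conductor R T \<iota> \<cc> \<longleftrightarrow>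
    inj_on \<iota> (carrier R) \<and> common_ideal R T \<iota> \<cc> \<and> (\<forall>K. common_ideal R T \<iota> K \<longrightarrow> K \<subseteq> \<cc>)"

text \<open>
  The maps \<open>\<iota>1\<close> and \<open>\<mu>2\<close> are prescribed on representatives. As in the library's first
  isomorphism theorem, \<open>the_elem\<close> picks the common value over all representatives;
  that this value is well defined is to be proved, not part of the definition.
\<close>

definition bi_iota1 ::
  "('a, 'm) ring_scheme \<Rightarrow> ('b, 'n) ring_scheme \<Rightarrow> ('c, 'k) ring_scheme \<Rightarrow>
   ('a \<Rightarrow> 'b) \<Rightarrow> ('a \<Rightarrow> 'c) \<Rightarrow> 'b set \<Rightarrow> 'c set \<Rightarrow> 'a set \<Rightarrow> 'b set \<times> 'c set"
  where "bi_iota1 A B C f g J J' Z =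
    the_elem {(J +>\<^bsub>image_plus_ideal A B f J\<^esub> f a, J' +>\<^bsub>image_plus_ideal A C g J'\<^esub> g a) | a. a \<in> Z}"

definition bi_mu2 ::
  "('a, 'm) ring_scheme \<Rightarrow> ('b, 'n) ring_scheme \<Rightarrow> ('c, 'k) ring_scheme \<Rightarrow>
   ('a \<Rightarrow> 'b) \<Rightarrow> ('a \<Rightarrow> 'c) \<Rightarrow> 'b set \<Rightarrow> 'c set \<Rightarrow> 'a set \<Rightarrow> 'b \<times> 'c \<Rightarrow> 'a set"
  where "bi_mu2 A B C f g J J' I p =
    the_elem {I +>\<^bsub>A\<^esub> a | a j j'. a \<in> carrier A \<and> j \<in> J \<and> j' \<in> J' \<and>
                               p = (f a \<oplus>\<^bsub>B\<^esub> j, g a \<oplus>\<^bsub>C\<^esub> j')}"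

definition bi_mu1 ::
  "('a, 'm) ring_scheme \<Rightarrow> ('b, 'n) ring_scheme \<Rightarrow> ('c, 'k) ring_scheme \<Rightarrow>
   ('a \<Rightarrow> 'b) \<Rightarrow> ('a \<Rightarrow> 'c) \<Rightarrow> 'b set \<Rightarrow> 'c set \<Rightarrow> 'b \<times> 'c \<Rightarrow> 'b set \<times> 'c set"
  where "bi_mu1 A B C f g J J' =
    (\<lambda>(x, y). (J +>\<^bsub>image_plus_ideal A B f J\<^esub> x, J' +>\<^bsub>image_plus_ideal A C g J'\<^esub> y))"

end

theory Submission
  imports Defs
begin

text \<open>
  Modulo \<open>J\<close>, the element \<open>f a + j\<close> is \<open>f a\<close>, and \<open>f a\<close>, \<open>f b\<close> agree modulo \<open>J\<close> iff \<open>a\<close>, \<open>b\<close> agree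
  modulo \<open>I = f\<^sup>-\<^sup>1(J)\<close>; likewise for \<open>g\<close>. Hence \<open>(x, y)\<close> lies in the bi-amalgamation with class
  \<open>I + a\<close> exactly when \<open>\<mu>1 (x, y) = \<iota>1 (I + a)\<close>, which is the pullback property. For
  maximality of \<open>J \<times> J'\<close>: if \<open>(x, y)\<close> lies in a common ideal, then so does \<open>(x, y) (1, 0) = (x, 0)\<close>,
  say \<open>(x, 0) = (f a + j, g a + j')\<close>; then \<open>g a \<in> J'\<close>, so \<open>a \<in> I\<close> and \<open>x \<in> J\<close>.
\<close>

section \<open>Direct products of rings\<close>

lemma RDirProd_simps:
  "x \<in> carrier (RDirProd R S) \<longleftrightarrow> fst x \<in> carrier R \<and> snd x \<in> carrier S"
  "x \<otimes>\<^bsub>RDirProd R S\<^esub> y = (fst x \<otimes>\<^bsub>R\<^esub> fst y, snd x \<otimes>\<^bsub>S\<^esub> snd y)"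
  "x \<oplus>\<^bsub>RDirProd R S\<^esub> y = (fst x \<oplus>\<^bsub>R\<^esub> fst y, snd x \<oplus>\<^bsub>S\<^esub> snd y)"
  "\<one>\<^bsub>RDirProd R S\<^esub> = (\<one>\<^bsub>R\<^esub>, \<one>\<^bsub>S\<^esub>)"
  "\<zero>\<^bsub>RDirProd R S\<^esub> = (\<zero>\<^bsub>R\<^esub>, \<zero>\<^bsub>S\<^esub>)"
  by (auto simp: RDirProd_def DirProd_def monoid.defs mem_Times_iff split: prod.splits)

lemma RDirProd_cring:
  assumes "cring R" and "cring S"
  shows "cring (RDirProd R S)"
proof -
  interpret R: cring R by fact
  interpret S: cring S by fact
  interpret P: ring "RDirProd R S"
    by (rule RDirProd_ring) unfold_locales
  show ?thesis
    by unfold_locales (auto simp: RDirProd_simps R.m_comm S.m_comm)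
qed

lemma RDirProd_hom_pair:
  assumes "f \<in> ring_hom A R" and "g \<in> ring_hom A S"
  shows "(\<lambda>a. (f a, g a)) \<in> ring_hom A (RDirProd R S)"
  using assms by (auto simp: ring_hom_def RDirProd_simps)

section \<open>Ideals and their cosets\<close>

lemma idealI':
  fixes R (structure)
  assumes "ring R" and "K \<subseteq> carrier R" and "\<zero> \<in> K"
    and "\<And>x y. x \<in> K \<Longrightarrow> y \<in> K \<Longrightarrow> x \<oplus> y \<in> K"
    and l: "\<And>x r. x \<in> K \<Longrightarrow> r \<in> carrier R \<Longrightarrow> r \<otimes> x \<in> K"
    and r: "\<And>x r. x \<in> K \<Longrightarrow> r \<in> carrier R \<Longrightarrow> x \<otimes> r \<in> K"
  shows "ideal K R"
proof -
  interpret ring R by fact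
  \<comment> \<open>Absorption applied to the scalar -1 yields negatives, so closure under addition
    is enough for an additive subgroup.\<close>
  have "\<ominus> x \<in> K" if "x \<in> K" for x
    using l[OF that, of "\<ominus> \<one>"] that assms(2) by (auto simp: l_minus)
  then have "subgroup K (add_monoid R)"
    using assms(2-4) by (intro add.subgroupI) auto
  then show ?thesis
    using l r by (intro idealI ring_axioms) auto
qed

lemma RDirProd_ideal:
  assumes "ideal J R" and "ideal J' S"
  shows "ideal (J \<times> J') (RDirProd R S)"
proof -
  interpret J: ideal J R by fact
  interpret J': ideal J' S by fact
  show ?thesis
    by (rule idealI')
      (auto simp: RDirProd_simps J.a_closed J'.a_closed J.I_l_closed J'.I_l_closed
        J.I_r_closed J'.I_r_closed intro: RDirProd_ring J.ring_axioms J'.ring_axioms)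
qed

lemma (in ring) ideal_restrict:
  assumes "ideal K R" and "subring H R" and "K \<subseteq> H"
  shows "ideal K (R\<lparr>carrier := H\<rparr>)"
proof -
  interpret K: ideal K R by fact
  show ?thesis
    using assms subringE(1)[OF assms(2)]
    by (intro idealI' subring_is_ring) (auto simp: K.a_closed K.I_l_closed K.I_r_closed)
qed

text \<open>The right-hand side has the shape of the generators \<open>f a + j\<close> of the
  bi-amalgamation, so membership there becomes an equation between cosets.\<close>

lemma (in ideal) a_rcos_eq_iff:
  assumes "x \<in> carrier R" and "y \<in> carrier R"
  shows "I +> x = I +> y \<longleftrightarrow> (\<exists>j\<in>I. x = y \<oplus> j)"
proof -
  have "I +> x = I +> y \<longleftrightarrow> x \<in> I +> y"
    using assms a_repr_independence'[of x y] a_rcos_self[of x] by auto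
  also have "\<dots> \<longleftrightarrow> (\<exists>j\<in>I. x = y \<oplus> j)"
    using assms by (auto simp: a_r_coset_def' a_comm)
  finally show ?thesis .
qed

lemma (in ideal) a_rcos_eq_ideal_iff:
  assumes "x \<in> carrier R"
  shows "I +> x = I \<longleftrightarrow> x \<in> I"
  using assms a_rcos_self[of x] a_coset_join2[OF _ a_subgroup] by auto

text \<open>Both sides say that \<open>h a - h b = h (a - b)\<close> lies in \<open>J\<close>. For
  \<open>f\<close> and \<open>g\<close> one direction makes the map on \<open>A/I\<close> well
  defined and the other makes it injective.\<close>

lemma (in ring_hom_ring) a_rcos_vimage_eq_iff:
  assumes "ideal J S" and "a \<in> carrier R" and "b \<in> carrier R"
  shows "{r \<in> carrier R. h r \<in> J} +>\<^bsub>R\<^esub> a = {r \<in> carrier R. h r \<in> J} +>\<^bsub>R\<^esub> b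
    \<longleftrightarrow> J +>\<^bsub>S\<^esub> h a = J +>\<^bsub>S\<^esub> h b"
  using assms
  by (simp add: a_minus_def flip: R.quotient_eq_iff_same_a_r_cos[OF ideal_vimage[OF assms(1)]]
      S.quotient_eq_iff_same_a_r_cos)

section \<open>The subring f(A) + J\<close>

lemma set_add_image:
  "f ` U <+>\<^bsub>B\<^esub> J = {f a \<oplus>\<^bsub>B\<^esub> j | a j. a \<in> U \<and> j \<in> J}"
  by (auto simp: set_add_def')

lemma image_plus_ideal_simps:
  "x \<otimes>\<^bsub>image_plus_ideal A B f J\<^esub> y = x \<otimes>\<^bsub>B\<^esub> y"
  "x \<oplus>\<^bsub>image_plus_ideal A B f J\<^esub> y = x \<oplus>\<^bsub>B\<^esub> y"
  "\<one>\<^bsub>image_plus_ideal A B f J\<^esub> = \<one>\<^bsub>B\<^esub>"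
  by (simp_all add: image_plus_ideal_def)

lemma (in ring_hom_ring) subring_image_plus_ideal:
  assumes "ideal J S"
  shows "subring (h ` carrier R <+>\<^bsub>S\<^esub> J) S"
proof -
  interpret J: ideal J S by fact
  let ?H = "h ` carrier R <+>\<^bsub>S\<^esub> J"
  have mem: "x \<in> ?H \<longleftrightarrow> (\<exists>a\<in>carrier R. \<exists>j\<in>J. x = h a \<oplus>\<^bsub>S\<^esub> j)" for x
    by (auto simp: set_add_image)
  show ?thesis
  proof (rule S.subringI)
    show "?H \<subseteq> carrier S"
      by (auto simp: mem)
    show "\<one>\<^bsub>S\<^esub> \<in> ?H"
      unfolding mem by (rule bexI[of _ "\<one>\<^bsub>R\<^esub>"], rule bexI[of _ "\<zero>\<^bsub>S\<^esub>"]) auto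
  next
    fix x assume "x \<in> ?H"
    then obtain a j where "a \<in> carrier R" "j \<in> J" "x = h a \<oplus>\<^bsub>S\<^esub> j"
      unfolding mem by blast
    then have "\<ominus>\<^bsub>S\<^esub> x = h (\<ominus>\<^bsub>R\<^esub> a) \<oplus>\<^bsub>S\<^esub> \<ominus>\<^bsub>S\<^esub> j" "\<ominus>\<^bsub>R\<^esub> a \<in> carrier R" "\<ominus>\<^bsub>S\<^esub> j \<in> J"
      by (simp_all add: S.minus_add)
    then show "\<ominus>\<^bsub>S\<^esub> x \<in> ?H"
      unfolding mem by blast
  next
    fix x y assume "x \<in> ?H" "y \<in> ?H"
    then obtain a j b k where ab: "a \<in> carrier R" "b \<in> carrier R" and jk: "j \<in> J" "k \<in> J"
      and xy: "x = h a \<oplus>\<^bsub>S\<^esub> j" "y = h b \<oplus>\<^bsub>S\<^esub> k"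
      unfolding mem by blast
    have "x \<oplus>\<^bsub>S\<^esub> y = h (a \<oplus>\<^bsub>R\<^esub> b) \<oplus>\<^bsub>S\<^esub> (j \<oplus>\<^bsub>S\<^esub> k)"
      using ab jk by (simp add: xy S.a_ac)
    then show "x \<oplus>\<^bsub>S\<^esub> y \<in> ?H"
      unfolding mem using ab jk by (metis R.add.m_closed J.a_closed)
    \<comment> \<open>Expanding (h a + j)(h b + k) leaves, besides h(ab), three terms that each
      contain a factor from \<open>J\<close>.\<close>
    let ?l = "h a \<otimes>\<^bsub>S\<^esub> k \<oplus>\<^bsub>S\<^esub> (j \<otimes>\<^bsub>S\<^esub> h b \<oplus>\<^bsub>S\<^esub> j \<otimes>\<^bsub>S\<^esub> k)"
    have "x \<otimes>\<^bsub>S\<^esub> y = h (a \<otimes>\<^bsub>R\<^esub> b) \<oplus>\<^bsub>S\<^esub> ?l"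
      using ab jk by (simp add: xy S.l_distr S.r_distr S.a_ac)
    moreover have "?l \<in> J"
      using ab jk by (simp add: J.a_closed J.I_l_closed J.I_r_closed)
    ultimately show "x \<otimes>\<^bsub>S\<^esub> y \<in> ?H"
      unfolding mem using ab by blast
  qed
qed

lemma
  assumes "cring A" and "cring B" and "f \<in> ring_hom A B" and "ideal J B"
  shows cring_image_plus_ideal: "cring (image_plus_ideal A B f J)"
    and ideal_image_plus_ideal: "ideal J (image_plus_ideal A B f J)"
    and hom_image_plus_ideal: "f \<in> ring_hom A (image_plus_ideal A B f J)"
proof -
  interpret A: cring A by fact
  interpret B: cring B by fact
  interpret ring_hom_ring A B f
    by (intro ring_hom_ringI2 A.ring_axioms B.ring_axioms assms)
  interpret J: ideal J B by fact
  have sub: "subring (f ` carrier A <+>\<^bsub>B\<^esub> J) B"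
    by (rule subring_image_plus_ideal) fact
  show "cring (image_plus_ideal A B f J)"
    unfolding image_plus_ideal_def
    using B.subcringI'[OF sub] B.subcring_iff[OF subringE(1)[OF sub]] by blast
  have "j \<in> f ` carrier A <+>\<^bsub>B\<^esub> J" if "j \<in> J" for j
    unfolding set_add_image using that by (auto intro!: exI[of _ "\<zero>\<^bsub>A\<^esub>"] exI[of _ j])
  then show "ideal J (image_plus_ideal A B f J)"
    unfolding image_plus_ideal_def by (intro B.ideal_restrict sub assms) auto
  have "f a \<in> f ` carrier A <+>\<^bsub>B\<^esub> J" if "a \<in> carrier A" for a
    unfolding set_add_image using that by (auto intro!: exI[of _ a] exI[of _ "\<zero>\<^bsub>B\<^esub>"])
  then show "f \<in> ring_hom A (image_plus_ideal A B f J)"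
    by (intro ring_hom_memI) (auto simp: image_plus_ideal_def)
qed

text \<open>The bi-amalgamation is itself of the form f(A) + J, for the map from \<open>A\<close> to
  the product of \<open>B\<close> and \<open>C\<close> and the ideal \<open>J \<times> J'\<close>.
  Its ring structure, and the fact that \<open>J \<times> J'\<close> is an ideal of it, are thus
  instances of the results above.\<close>

lemma bi_amalgamation_eq_image_plus_ideal:
  "bi_amalgamation A B C f g J J' =
    image_plus_ideal A (RDirProd B C) (\<lambda>a. (f a, g a)) (J \<times> J')"
  unfolding bi_amalgamation_def image_plus_ideal_def set_add_image
  by (rule arg_cong[where f = "\<lambda>U. carrier_update (\<lambda>_. U) _"])
    (auto simp: RDirProd_simps)

theorem proposition3p2:
  fixes A :: "('a, 'm) ring_scheme"
    and B :: "('b, 'n) ring_scheme"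
    and C :: "('c, 'k) ring_scheme"
    and f :: "'a \<Rightarrow> 'b" and g :: "'a \<Rightarrow> 'c"
    and J :: "'b set" and J' :: "'c set" and I :: "'a set"
  assumes "cring A" and "cring B" and "cring C"
    and "f \<in> ring_hom A B" and "g \<in> ring_hom A C"
    and "ideal J B" and "ideal J' C"
    and "I = {a \<in> carrier A. f a \<in> J}" and "I = {a \<in> carrier A. g a \<in> J'}"
  defines "R \<equiv> bi_amalgamation A B C f g J J'"
    and "BJ \<equiv> image_plus_ideal A B f J"
    and "CJ \<equiv> image_plus_ideal A C g J'"
    and "\<iota>1 \<equiv> bi_iota1 A B C f g J J'"
    and "\<mu>2 \<equiv> bi_mu2 A B C f g J J' I"
    and "\<iota>2 \<equiv> (\<lambda>p :: 'b \<times> 'c. p)"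
    and "\<mu>1 \<equiv> bi_mu1 A B C f g J J'"
  defines "T \<equiv> RDirProd BJ CJ"
    and "D \<equiv> RDirProd (BJ Quot J) (CJ Quot J')"
  shows "(\<forall>a \<in> carrier A. \<iota>1 (I +>\<^bsub>A\<^esub> a) = (J +>\<^bsub>BJ\<^esub> f a, J' +>\<^bsub>CJ\<^esub> g a)) \<and>
    (\<forall>a \<in> carrier A. \<forall>j \<in> J. \<forall>j' \<in> J'. \<mu>2 (f a \<oplus>\<^bsub>B\<^esub> j, g a \<oplus>\<^bsub>C\<^esub> j') = I +>\<^bsub>A\<^esub> a) \<and>
    conductor_square R T (A Quot I) D \<iota>2 \<mu>2 \<mu>1 \<iota>1 \<and>
    is_conductor R T \<iota>2 (a_kernel T D \<mu>1) \<and>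
    a_kernel T D \<mu>1 = J \<times> J'"
proof -

  \<comment> \<open>The rings and ideals of the square\<close>
  note cring_B = cring_image_plus_ideal[OF assms(1,2,4,6), folded BJ_def]
    and cring_C = cring_image_plus_ideal[OF assms(1,3,5,7), folded CJ_def]
    and ideal_B = ideal_image_plus_ideal[OF assms(1,2,4,6), folded BJ_def]
    and ideal_C = ideal_image_plus_ideal[OF assms(1,3,5,7), folded CJ_def]
    and hom_f = hom_image_plus_ideal[OF assms(1,2,4,6), folded BJ_def]
    and hom_g = hom_image_plus_ideal[OF assms(1,3,5,7), folded CJ_def]
  interpret A: cring A by fact
  interpret BJ: cring BJ by (fact cring_B)
  interpret CJ: cring CJ by (fact cring_C)
  interpret f: ring_hom_ring A BJ f
    by (intro ring_hom_ringI2 A.ring_axioms BJ.ring_axioms hom_f)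
  interpret g: ring_hom_ring A CJ g
    by (intro ring_hom_ringI2 A.ring_axioms CJ.ring_axioms hom_g)
  interpret J: ideal J BJ by (fact ideal_B)
  interpret J': ideal J' CJ by (fact ideal_C)
  interpret I: ideal I A
    unfolding \<open>I = {a \<in> carrier A. f a \<in> J}\<close> by (rule f.ideal_vimage) (fact ideal_B)
  note R_eq_image = R_def[unfolded bi_amalgamation_eq_image_plus_ideal]
    and BC = assms(1) RDirProd_cring[OF assms(2,3)] RDirProd_hom_pair[OF assms(4,5)]
      RDirProd_ideal[OF assms(6,7)]
  note cring_R = cring_image_plus_ideal[OF BC, folded R_eq_image]
    and ideal_R = ideal_image_plus_ideal[OF BC, folded R_eq_image]
  interpret R: cring R by (fact cring_R)
  interpret T: cring T unfolding T_def by (intro RDirProd_cring cring_B cring_C)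
  interpret D: cring D
    unfolding D_def by (intro RDirProd_cring J.quotient_is_cring J'.quotient_is_cring cring_B cring_C)
  interpret Q: cring "A Quot I" by (intro I.quotient_is_cring A.cring_axioms)
  have ideal_T: "ideal (J \<times> J') T"
    unfolding T_def by (intro RDirProd_ideal ideal_B ideal_C)

  \<comment> \<open>The bi-amalgamation described through \<open>\<mu>1\<close>\<close>
  have B_ops: "x \<oplus>\<^bsub>BJ\<^esub> y = x \<oplus>\<^bsub>B\<^esub> y" "x \<otimes>\<^bsub>BJ\<^esub> y = x \<otimes>\<^bsub>B\<^esub> y" "\<one>\<^bsub>BJ\<^esub> = \<one>\<^bsub>B\<^esub>" for x y
    by (simp_all add: BJ_def image_plus_ideal_simps)
  have C_ops: "x \<oplus>\<^bsub>CJ\<^esub> y = x \<oplus>\<^bsub>C\<^esub> y" "x \<otimes>\<^bsub>CJ\<^esub> y = x \<otimes>\<^bsub>C\<^esub> y" "\<one>\<^bsub>CJ\<^esub> = \<one>\<^bsub>C\<^esub>" for x y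
    by (simp_all add: CJ_def image_plus_ideal_simps)
  have R_ops: "x \<oplus>\<^bsub>R\<^esub> y = x \<oplus>\<^bsub>T\<^esub> y" "x \<otimes>\<^bsub>R\<^esub> y = x \<otimes>\<^bsub>T\<^esub> y" "\<one>\<^bsub>R\<^esub> = \<one>\<^bsub>T\<^esub>" for x y
    by (simp_all add: R_def T_def bi_amalgamation_def RDirProd_simps B_ops C_ops)

  \<comment> \<open>The composite of \<open>h\<close> with \<open>\<mu>1\<close> is the map on
    \<open>A\<close> that induces \<open>\<iota>1\<close>; all later arguments compare
    \<open>\<mu>1 p\<close> with \<open>\<mu>1 (h a)\<close>.\<close>
  define h where "h a = (f a, g a)" for a
  have hom_h: "h \<in> ring_hom A T"
    unfolding h_def T_def by (intro RDirProd_hom_pair hom_f hom_g)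
  interpret h: ring_hom_ring A T h
    by (intro ring_hom_ringI2 A.ring_axioms T.ring_axioms hom_h)

  have \<mu>1: "\<mu>1 = (\<lambda>(x, y). (J +>\<^bsub>BJ\<^esub> x, J' +>\<^bsub>CJ\<^esub> y))"
    by (simp add: \<mu>1_def bi_mu1_def BJ_def CJ_def)
  have hom_\<mu>1: "\<mu>1 \<in> ring_hom T D"
    unfolding \<mu>1 T_def D_def by (intro RDirProd_hom3 J.rcos_ring_hom J'.rcos_ring_hom)
  interpret \<mu>1: ring_hom_ring T D \<mu>1
    by (intro ring_hom_ringI2 T.ring_axioms D.ring_axioms hom_\<mu>1)

  \<comment> \<open>The fibre of \<open>\<mu>1\<close> through \<open>h a\<close> is the coset of
    \<open>J \<times> J'\<close> containing \<open>h a\<close>.\<close>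
  have \<mu>1_eq_iff: "\<mu>1 p = \<mu>1 (h a) \<longleftrightarrow> (\<exists>j\<in>J. \<exists>j'\<in>J'. p = (f a \<oplus>\<^bsub>B\<^esub> j, g a \<oplus>\<^bsub>C\<^esub> j'))"
    if "p \<in> carrier T" "a \<in> carrier A" for p a
    using that
    by (cases p) (auto simp: \<mu>1 h_def T_def RDirProd_simps J.a_rcos_eq_iff J'.a_rcos_eq_iff B_ops C_ops)
  \<comment> \<open>As \<open>I\<close> is the preimage of \<open>J\<close> and of
    \<open>J'\<close>, the equation in either coordinate alone already amounts to equality of the
    cosets of \<open>I\<close>.\<close>
  have \<mu>1_h_eq_iff: "\<mu>1 (h a) = \<mu>1 (h b) \<longleftrightarrow> I +>\<^bsub>A\<^esub> a = I +>\<^bsub>A\<^esub> b"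
    if "a \<in> carrier A" "b \<in> carrier A" for a b
    using f.a_rcos_vimage_eq_iff[OF ideal_B that] g.a_rcos_vimage_eq_iff[OF ideal_C that]
    by (auto simp: \<mu>1 h_def simp flip: assms(8,9))
  have in_T: "(f a \<oplus>\<^bsub>B\<^esub> j, g a \<oplus>\<^bsub>C\<^esub> j') \<in> carrier T"
    if "a \<in> carrier A" "j \<in> J" "j' \<in> J'" for a j j'
    using that J.Icarr J'.Icarr by (auto simp: T_def RDirProd_simps simp flip: B_ops C_ops)
  \<comment> \<open>Hence \<open>R\<close> is the preimage under \<open>\<mu>1\<close> of the image
    of \<open>A\<close> in \<open>D\<close>.\<close>
  have carrier_R: "carrier R = {p \<in> carrier T. \<exists>a\<in>carrier A. \<mu>1 p = \<mu>1 (h a)}"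
  proof -
    have "carrier R = {(f a \<oplus>\<^bsub>B\<^esub> j, g a \<oplus>\<^bsub>C\<^esub> j') | a j j'. a \<in> carrier A \<and> j \<in> J \<and> j' \<in> J'}"
      by (simp add: R_def bi_amalgamation_def)
    also have "\<dots> = {p \<in> carrier T. \<exists>a\<in>carrier A. \<mu>1 p = \<mu>1 (h a)}"
      using in_T \<mu>1_eq_iff by (auto; metis)
    finally show ?thesis .
  qed

  \<comment> \<open>Well-definedness of \<open>\<iota>1\<close> and \<open>\<mu>2\<close>\<close>
  have \<iota>1: "\<iota>1 (I +>\<^bsub>A\<^esub> a) = \<mu>1 (h a)" if a: "a \<in> carrier A" for a
  proof -
    have "\<mu>1 (h b) = \<mu>1 (h a)" if "b \<in> I +>\<^bsub>A\<^esub> a" for b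
    proof -
      have "b \<in> carrier A"
        using that a I.a_subset A.a_r_coset_subset_G by blast
      then show ?thesis
        using a that \<mu>1_h_eq_iff I.a_repr_independence'[of b a] by auto
    qed
    \<comment> \<open>Only a singleton gives \<open>the_elem\<close> a determined value. The set is
      nonempty because \<open>a\<close> lies in its own coset.\<close>
    then have "{\<mu>1 (h b) | b. b \<in> I +>\<^bsub>A\<^esub> a} = {\<mu>1 (h a)}"
      using I.a_rcos_self[OF a] by blast
    then show ?thesis
      by (simp add: \<iota>1_def bi_iota1_def \<mu>1 h_def BJ_def CJ_def)
  qed
  have \<mu>2: "\<mu>2 p = I +>\<^bsub>A\<^esub> a" if "p \<in> carrier T" "a \<in> carrier A" "\<mu>1 p = \<mu>1 (h a)" for p a
  proof -
    \<comment> \<open>The decompositions of \<open>p\<close> as an element of \<open>R\<close>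
      correspond to the \<open>b\<close> with \<open>\<mu>1 p = \<mu>1 (h b)\<close>, and
      \<open>\<mu>1_h_eq_iff\<close> puts all such \<open>b\<close> into one coset of
      \<open>I\<close>.\<close>
    have "{I +>\<^bsub>A\<^esub> b | b j j'. b \<in> carrier A \<and> j \<in> J \<and> j' \<in> J' \<and>
        p = (f b \<oplus>\<^bsub>B\<^esub> j, g b \<oplus>\<^bsub>C\<^esub> j')} = {I +>\<^bsub>A\<^esub> b | b. b \<in> carrier A \<and> \<mu>1 p = \<mu>1 (h b)}"
      using \<mu>1_eq_iff[OF that(1)] by blast
    also have "\<dots> = {I +>\<^bsub>A\<^esub> a}"
      using that \<mu>1_h_eq_iff by auto
    finally show ?thesis
      by (simp add: \<mu>2_def bi_mu2_def)
  qed
  have R_cases: thesis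
    if "p \<in> carrier R" "\<And>a. a \<in> carrier A \<Longrightarrow> p \<in> carrier T \<Longrightarrow> \<mu>1 p = \<mu>1 (h a) \<Longrightarrow>
      \<mu>2 p = I +>\<^bsub>A\<^esub> a \<Longrightarrow> thesis" for p thesis
    using that \<mu>2 unfolding carrier_R by blast
  have carrier_Q: "carrier (A Quot I) = (\<lambda>a. I +>\<^bsub>A\<^esub> a) ` carrier A"
    by (auto simp: FactRing_def A_RCOSETS_def')

  \<comment> \<open>The maps of the square are homomorphisms\<close>
  have hom_Q: "(+>\<^bsub>A\<^esub>) I \<in> ring_hom A (A Quot I)"
    by (rule I.rcos_ring_hom)
  have hom_\<iota>2: "\<iota>2 \<in> ring_hom R T"
    by (rule ring_hom_memI) (auto simp: \<iota>2_def R_ops carrier_R)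
  have hom_\<mu>2: "\<mu>2 \<in> ring_hom R (A Quot I)"
  proof (rule ring_hom_memI)
    show "\<mu>2 p \<in> carrier (A Quot I)" if "p \<in> carrier R" for p
      using that by (rule R_cases) (auto simp: carrier_Q)
    show "\<mu>2 \<one>\<^bsub>R\<^esub> = \<one>\<^bsub>A Quot I\<^esub>"
      using \<mu>2[of "\<one>\<^bsub>R\<^esub>" "\<one>\<^bsub>A\<^esub>"] ring_hom_one[OF hom_Q] by (simp add: R_ops)
    fix p q assume "p \<in> carrier R" "q \<in> carrier R"
    \<comment> \<open>If \<open>a\<close> and \<open>b\<close> represent \<open>p\<close> and
      \<open>q\<close>, then their product and sum represent those of \<open>p\<close> and
      \<open>q\<close>, since \<open>\<mu>1\<close> and \<open>h\<close> are homomorphisms.\<close>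
    then obtain a b where ab: "a \<in> carrier A" "b \<in> carrier A" "p \<in> carrier T" "q \<in> carrier T"
      "\<mu>1 p = \<mu>1 (h a)" "\<mu>1 q = \<mu>1 (h b)" "\<mu>2 p = I +>\<^bsub>A\<^esub> a" "\<mu>2 q = I +>\<^bsub>A\<^esub> b"
      by (metis R_cases)
    show "\<mu>2 (p \<otimes>\<^bsub>R\<^esub> q) = \<mu>2 p \<otimes>\<^bsub>A Quot I\<^esub> \<mu>2 q"
      using ab \<mu>2[of "p \<otimes>\<^bsub>T\<^esub> q" "a \<otimes>\<^bsub>A\<^esub> b"] ring_hom_mult[OF hom_Q, of a b] by (simp add: R_ops)
    show "\<mu>2 (p \<oplus>\<^bsub>R\<^esub> q) = \<mu>2 p \<oplus>\<^bsub>A Quot I\<^esub> \<mu>2 q"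
      using ab \<mu>2[of "p \<oplus>\<^bsub>T\<^esub> q" "a \<oplus>\<^bsub>A\<^esub> b"] ring_hom_add[OF hom_Q, of a b] by (simp add: R_ops)
  qed
  have hom_\<iota>1: "\<iota>1 \<in> ring_hom (A Quot I) D"
  proof (rule ring_hom_memI)
    show "\<iota>1 Z \<in> carrier D" if "Z \<in> carrier (A Quot I)" for Z
      using that by (auto simp: carrier_Q \<iota>1)
    show "\<iota>1 \<one>\<^bsub>A Quot I\<^esub> = \<one>\<^bsub>D\<^esub>"
      by (simp add: \<iota>1 flip: ring_hom_one[OF hom_Q])
    fix Y Z assume "Y \<in> carrier (A Quot I)" "Z \<in> carrier (A Quot I)"
    then obtain a b where "a \<in> carrier A" "b \<in> carrier A" "Y = I +>\<^bsub>A\<^esub> a" "Z = I +>\<^bsub>A\<^esub> b"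
      by (auto simp: carrier_Q)
    \<comment> \<open>Reading the rules for the projection onto A/I backwards merges the two cosets
      into one, on which \<open>\<iota>1\<close> is given by
      \<open>\<mu>1 \<circ> h\<close>.\<close>
    then show "\<iota>1 (Y \<otimes>\<^bsub>A Quot I\<^esub> Z) = \<iota>1 Y \<otimes>\<^bsub>D\<^esub> \<iota>1 Z"
      and "\<iota>1 (Y \<oplus>\<^bsub>A Quot I\<^esub> Z) = \<iota>1 Y \<oplus>\<^bsub>D\<^esub> \<iota>1 Z"
      by (simp_all add: \<iota>1 flip: ring_hom_mult[OF hom_Q] ring_hom_add[OF hom_Q])
  qed

  \<comment> \<open>The pullback property and the conductor square\<close>
  have "(\<lambda>r. (\<iota>2 r, \<mu>2 r)) ` carrier R = carrier (fiber_product T (A Quot I) \<mu>1 \<iota>1)"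
  proof (intro equalityI subsetI)
    fix z assume "z \<in> (\<lambda>r. (\<iota>2 r, \<mu>2 r)) ` carrier R"
    then show "z \<in> carrier (fiber_product T (A Quot I) \<mu>1 \<iota>1)"
      by (auto simp: fiber_product_def \<iota>2_def carrier_Q \<iota>1 elim!: R_cases)
  next
    fix z assume "z \<in> carrier (fiber_product T (A Quot I) \<mu>1 \<iota>1)"
    then obtain p a where "z = (p, I +>\<^bsub>A\<^esub> a)" "p \<in> carrier T" "a \<in> carrier A" "\<mu>1 p = \<mu>1 (h a)"
      by (auto simp: fiber_product_def carrier_Q \<iota>1)
    then show "z \<in> (\<lambda>r. (\<iota>2 r, \<mu>2 r)) ` carrier R"
      by (auto simp: \<iota>2_def carrier_R \<mu>2 intro!: rev_image_eqI[of p])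
  qed
  \<comment> \<open>Injectivity is immediate, because the first component \<open>\<iota>2\<close> is
    the identity.\<close>
  then have "bij_betw (\<lambda>r. (\<iota>2 r, \<mu>2 r)) (carrier R) (carrier (fiber_product T (A Quot I) \<mu>1 \<iota>1))"
    by (simp add: bij_betw_def inj_on_def \<iota>2_def)
  moreover have "(\<lambda>r. (\<iota>2 r, \<mu>2 r)) \<in> ring_hom R (RDirProd T (A Quot I))"
    by (intro RDirProd_hom_pair hom_\<iota>2 hom_\<mu>2)
  \<comment> \<open>The fibre product inherits the operations of the direct product; the bijection
    supplies that values land in the smaller carrier.\<close>
  ultimately have "(\<lambda>r. (\<iota>2 r, \<mu>2 r)) \<in> ring_iso R (fiber_product T (A Quot I) \<mu>1 \<iota>1)"
    unfolding fiber_product_def by (auto simp: ring_iso_def ring_hom_def dest: bij_betwE)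
  then have "pullback_square R T (A Quot I) D \<iota>2 \<mu>2 \<mu>1 \<iota>1"
    unfolding pullback_square_def
    using hom_\<iota>2 hom_\<mu>2 hom_\<mu>1 hom_\<iota>1
      R.cring_axioms T.cring_axioms Q.cring_axioms D.cring_axioms by blast
  moreover have "\<mu>1 ` carrier T = carrier D"
    unfolding \<mu>1 T_def D_def
    by (force simp: RDirProd_carrier FactRing_def A_RCOSETS_def')
  moreover have "inj_on \<iota>1 (carrier (A Quot I))"
    by (auto simp: inj_on_def carrier_Q \<iota>1 \<mu>1_h_eq_iff)
  ultimately have square: "conductor_square R T (A Quot I) D \<iota>2 \<mu>2 \<mu>1 \<iota>1"
    by (simp add: conductor_square_def)

  \<comment> \<open>The kernel of \<open>\<mu>1\<close> and the conductor\<close>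
  have "\<mu>1 p = \<zero>\<^bsub>D\<^esub> \<longleftrightarrow> p \<in> J \<times> J'" if "p \<in> carrier T" for p
    using that J.a_rcos_eq_ideal_iff[of "fst p"] J'.a_rcos_eq_ideal_iff[of "snd p"]
    by (simp add: \<mu>1 T_def D_def RDirProd_simps FactRing_def mem_Times_iff case_prod_beta)
  then have kernel: "a_kernel T D \<mu>1 = J \<times> J'"
    unfolding a_kernel_def' using ideal.Icarr[OF ideal_T] by blast

  \<comment> \<open>Both records compute componentwise as in \<open>B\<close> and \<open>C\<close>,
    so \<open>R\<close> is literally the subring of \<open>T\<close> on its carrier, and a common
    ideal is an ideal of \<open>T\<close> and of \<open>R\<close>.\<close>
  have R_eq: "T\<lparr>carrier := carrier R\<rparr> = R"
    by (simp add: R_def T_def bi_amalgamation_def BJ_def CJ_def image_plus_ideal_def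
        RDirProd_def DirProd_def monoid.defs)
  have common: "common_ideal R T \<iota>2 K \<longleftrightarrow> ideal K T \<and> ideal K R" for K
    by (simp add: common_ideal_def \<iota>2_def R_eq)
  have "K \<subseteq> J \<times> J'" if K: "ideal K T" "ideal K R" for K
  proof
    interpret K: ideal K T by fact
    fix p assume p: "p \<in> K"
    have mem: "q \<in> carrier R" if "q \<in> K" for q
      using ideal.Icarr[OF K(2) that] .
    have p_T: "fst p \<in> carrier BJ" "snd p \<in> carrier CJ"
      using K.Icarr[OF p] by (auto simp: T_def RDirProd_simps)
    \<comment> \<open>The idempotents (1, 0) and (0, 1) are available because \<open>K\<close> is an
      ideal of all of \<open>T\<close>; the resulting products lie in \<open>R\<close> because
      \<open>K\<close> is also an ideal of \<open>R\<close>.\<close>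
    have "p \<otimes>\<^bsub>T\<^esub> (\<one>\<^bsub>BJ\<^esub>, \<zero>\<^bsub>CJ\<^esub>) \<in> K" "p \<otimes>\<^bsub>T\<^esub> (\<zero>\<^bsub>BJ\<^esub>, \<one>\<^bsub>CJ\<^esub>) \<in> K"
      by (intro K.I_r_closed p; simp add: T_def RDirProd_simps)+
    then have 1: "(fst p, \<zero>\<^bsub>CJ\<^esub>) \<in> carrier R" and 2: "(\<zero>\<^bsub>BJ\<^esub>, snd p) \<in> carrier R"
      using p_T mem by (auto simp: T_def RDirProd_simps)
    \<comment> \<open>By \<open>carrier_R\<close>, some \<open>h a\<close> agrees with (fst p, 0)
      modulo \<open>J \<times> J'\<close>: the first coordinate links \<open>fst p\<close> to
      \<open>f a\<close>, the second forces \<open>g a\<close> into \<open>J'\<close>.\<close>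
    from 1 obtain a where a: "a \<in> carrier A" "J +>\<^bsub>BJ\<^esub> fst p = J +>\<^bsub>BJ\<^esub> f a"
      "J' +>\<^bsub>CJ\<^esub> g a = J' +>\<^bsub>CJ\<^esub> \<zero>\<^bsub>CJ\<^esub>"
      by (auto simp: carrier_R \<mu>1 h_def)
    from 2 obtain b where b: "b \<in> carrier A" "J' +>\<^bsub>CJ\<^esub> snd p = J' +>\<^bsub>CJ\<^esub> g b"
      "J +>\<^bsub>BJ\<^esub> f b = J +>\<^bsub>BJ\<^esub> \<zero>\<^bsub>BJ\<^esub>"
      by (auto simp: carrier_R \<mu>1 h_def)
    have "g a \<in> J'" "f b \<in> J"
      using a b J.a_rcos_eq_ideal_iff[of "\<zero>\<^bsub>BJ\<^esub>"] J.a_rcos_eq_ideal_iff[of "f b"]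
        J'.a_rcos_eq_ideal_iff[of "\<zero>\<^bsub>CJ\<^esub>"] J'.a_rcos_eq_ideal_iff[of "g a"] by simp_all
    \<comment> \<open>Passing through \<open>I\<close> carries the information across coordinates:
      from \<open>g a\<close> to \<open>f a\<close>, and from \<open>f b\<close> to
      \<open>g b\<close>.\<close>
    then have "a \<in> I" "b \<in> I"
      using a(1) b(1) assms(8,9) by blast+
    then have "f a \<in> J" "g b \<in> J'"
      using assms(8,9) by blast+
    then have "fst p \<in> J" "snd p \<in> J'"
      using a b p_T J.a_rcos_eq_ideal_iff[of "fst p"] J.a_rcos_eq_ideal_iff[of "f a"]
        J'.a_rcos_eq_ideal_iff[of "snd p"] J'.a_rcos_eq_ideal_iff[of "g b"] by simp_all
    then show "p \<in> J \<times> J'"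
      by (simp add: mem_Times_iff)
  qed
  then have "is_conductor R T \<iota>2 (a_kernel T D \<mu>1)"
    unfolding is_conductor_def common kernel
    using ideal_T ideal_R by (simp add: \<iota>2_def)
  moreover have "\<mu>2 (f a \<oplus>\<^bsub>B\<^esub> j, g a \<oplus>\<^bsub>C\<^esub> j') = I +>\<^bsub>A\<^esub> a"
    if "a \<in> carrier A" "j \<in> J" "j' \<in> J'" for a j j'
    using \<mu>2[OF in_T[OF that] that(1)] \<mu>1_eq_iff[OF in_T[OF that] that(1)] that(2,3) by blast
  moreover have "\<iota>1 (I +>\<^bsub>A\<^esub> a) = (J +>\<^bsub>BJ\<^esub> f a, J' +>\<^bsub>CJ\<^esub> g a)" if "a \<in> carrier A" for a
    using \<iota>1[OF that] by (simp add: \<mu>1 h_def)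
  ultimately show ?thesis
    using square kernel by blast
qed

end
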